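(* There is a constant $c=c(d)>0$, depending only on $d$, such that the following hold for every convex body $C\subset\mathbb{R}^d$. (i) For every positive integer $k$ and every finite non-$\frac{k}{2}/C$-degenerate set $S\subset\mathbb{R}^d$ with $|S|\ge k$, we have $g(C,k,S)\ge c\,\frac{|S|}{k}$. (ii) For every real $k>0$ and every $C$-nice measure $\mu$ with $\mu(\mathbb{R}^d)> k$, we have $g(C,k,\mu)\ge c\,\frac{\mu(\mathbb{R}^d)}{k}$.
   Context: A convex body is a convex compact set with nonempty interior. A homothet of $C$ is a set $\lambda C+x$ with $x\in\mathbb{R}^d$, $\lambda>0$. A set $S$ is non-$t/C$-degenerate if the boundary of every homothet of $C$ contains at most $t$ points of $S$. Measures are Borel measures on $\mathbb{R}^d$ finite on compact sets; $\mu$ is non-$C$-degenerate if it vanishes on the boundary of every homothet of $C$, and $C$-nice if it is finite, non-$C$-degenerate, and there is a ball $K$ with $\mu(K)=\mu(\mathbb{R}^d)$. A $k^+/S$-homothet is a homothet of $C$ containing at least $k$ points of $S$; a $k^+/\mu$-homothet is a homothet of $C$ with $\mu$-measure at least $k$. $g(C,k,S)$ (resp. $g(C,k,\mu)$) is the maximum number of pairwise interior-disjoint $k^+/S$-homothets (resp. $k^+/\mu$-homothets) of $C$. *)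

theory Defs
  imports "HOL-Analysis.Analysis"
begin

definition convex_body :: "'a::euclidean_space set \<Rightarrow> bool" where
  "convex_body C \<longleftrightarrow> convex C \<and> compact C \<and> interior C \<noteq> {}"

definition homothets :: "'a::euclidean_space set \<Rightarrow> 'a set set" where
  "homothets C = {(\<lambda>y. l *\<^sub>R y + x) ` C | l x. l > 0}"

definition non_degenerate_pts :: "'a::euclidean_space set \<Rightarrow> real \<Rightarrow> 'a set \<Rightarrow> bool" where
  "non_degenerate_pts C t S \<longleftrightarrow>
     (\<forall>H \<in> homothets C. finite (S \<inter> frontier H) \<and> real (card (S \<inter> frontier H)) \<le> t)"

definition non_degenerate_meas :: "'a::euclidean_space set \<Rightarrow> 'a measure \<Rightarrow> bool" where
  "non_degenerate_meas C M \<longleftrightarrow> (\<forall>H \<in> homothets C. emeasure M (frontier H) = 0)"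

definition C_nice :: "'a::euclidean_space set \<Rightarrow> 'a measure \<Rightarrow> bool" where
  "C_nice C M \<longleftrightarrow> sets M = sets borel \<and> emeasure M (space M) < \<infinity>
     \<and> non_degenerate_meas C M
     \<and> (\<exists>x r. emeasure M (cball x r) = emeasure M (space M))"

definition pairwise_interior_disjoint :: "'a::euclidean_space set set \<Rightarrow> bool" where
  "pairwise_interior_disjoint F \<longleftrightarrow> pairwise (\<lambda>A B. interior A \<inter> interior B = {}) F"

definition kplus_pts_homothets :: "'a::euclidean_space set \<Rightarrow> nat \<Rightarrow> 'a set \<Rightarrow> 'a set set" where
  "kplus_pts_homothets C k S = {H \<in> homothets C. card (S \<inter> H) \<ge> k}"

definition kplus_meas_homothets :: "'a::euclidean_space set \<Rightarrow> real \<Rightarrow> 'a measure \<Rightarrow> 'a set set" where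
  "kplus_meas_homothets C k M = {H \<in> homothets C. emeasure M H \<ge> ennreal k}"

text \<open>g as the supremum (= maximum when attained; \<infinity> if unbounded) of the sizes of
  pairwise interior-disjoint families.\<close>
definition g_pts :: "'a::euclidean_space set \<Rightarrow> nat \<Rightarrow> 'a set \<Rightarrow> ereal" where
  "g_pts C k S = Sup {ereal (real (card F)) | F. finite F \<and> F \<subseteq> kplus_pts_homothets C k S
                       \<and> pairwise_interior_disjoint F}"

definition g_meas :: "'a::euclidean_space set \<Rightarrow> real \<Rightarrow> 'a measure \<Rightarrow> ereal" where
  "g_meas C k M = Sup {ereal (real (card F)) | F. finite F \<and> F \<subseteq> kplus_meas_homothets C k M
                       \<and> pairwise_interior_disjoint F}"

end

theory Submission
  imports Defs
begin

text \<open>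
  A Besicovitch covering argument. Each point \<open>x\<close> of a ball carrying the measure gets a
  homothet \<open>x + r(C - p)\<close> of minimal size with measure at least \<open>k\<close>; by the non-degeneracy
  its measure is at most \<open>3k/2\<close>, so any cover by such homothets has at least \<open>2\<mu>/(3k)\<close>
  members. Choose centres greedily outside the homothets already chosen, with radius at least
  half of the supremum. Then every chosen homothet meets at most \<open>N\<close> earlier ones, hence a
  fraction \<open>1/(N+1)\<close> of them is pairwise disjoint. As disjoint homothets have total measure at
  most \<open>\<mu>\<close>, this also shows that the selection stops. The number \<open>N\<close> depends only on the
  dimension because some affine image of \<open>C\<close> lies between two concentric balls whose radii have
  a ratio bounded in terms of the dimension. Point sets are treated as counting measures.
\<close>

section \<open>Affine position of a convex body\<close>

text \<open>
  The first vector is one of maximal norm in \<open>D\<close>; the others are lifted from the orthogonal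
  projection of \<open>D\<close> along it.
\<close>

lemma bounded_coordinates:
  "\<exists>A\<ge>0. \<forall>D::'a::euclidean_space set. compact D \<longrightarrow> D \<noteq> {} \<longrightarrow> dim D \<le> n \<longrightarrow>
     (\<exists>v. (\<forall>i<n. v i \<in> D) \<and>
       (\<forall>x\<in>D. \<exists>a. (\<forall>i<n. \<bar>a i\<bar> \<le> A) \<and> x = (\<Sum>i<n. a i *\<^sub>R v i)))"
proof (induction n)
  case 0
  show ?case by (intro exI[of _ 0]) auto
next
  case (Suc n)
  then obtain A where A: "A \<ge> 0" and IH: "\<And>D::'a set. compact D \<Longrightarrow> D \<noteq> {} \<Longrightarrow> dim D \<le> n \<Longrightarrow>
     (\<exists>v. (\<forall>i<n. v i \<in> D) \<and>
       (\<forall>x\<in>D. \<exists>a. (\<forall>i<n. \<bar>a i\<bar> \<le> A) \<and> x = (\<Sum>i<n. a i *\<^sub>R v i)))"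
    by blast
  \<comment> \<open>The lifted coordinates stay below \<open>A\<close> in absolute value, and the
    new coordinate along \<open>u\<close> will be at most \<open>1 + real n * A\<close>;
    \<open>A'\<close> dominates both.\<close>
  define A' where "A' = 1 + real n * A + A"
  have A': "A' \<ge> 0" "A \<le> A'" "1 + real n * A \<le> A'" using A by (auto simp: A'_def)
  show ?case
  proof (intro exI[of _ A'] conjI allI impI)
    fix D :: "'a set" assume D: "compact D" "D \<noteq> {}" "dim D \<le> Suc n"
    obtain u where u: "u \<in> D" "\<And>x. x \<in> D \<Longrightarrow> norm x \<le> norm u"
      using continuous_attains_sup[OF D(1,2), of norm] continuous_on_norm_id by blast
    show "\<exists>v. (\<forall>i<Suc n. v i \<in> D) \<and>
       (\<forall>x\<in>D. \<exists>a. (\<forall>i<Suc n. \<bar>a i\<bar> \<le> A') \<and> x = (\<Sum>i<Suc n. a i *\<^sub>R v i))"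
    proof (cases "u = 0")
      case True
      then have "\<And>x. x \<in> D \<Longrightarrow> x = 0" using u by simp
      then show ?thesis using u(1) A'(1) by (intro exI[of _ "\<lambda>_. u"]) (auto intro!: exI[of _ "\<lambda>_. 0"])
    next
      case False
      define P where "P x = x - ((x \<bullet> u) / (u \<bullet> u)) *\<^sub>R u" for x
      have lin: "linear P"
        by (rule linearI) (auto simp: P_def inner_add_left add_divide_distrib algebra_simps)
      have orth: "P x \<bullet> u = 0" for x using False by (simp add: P_def inner_diff_left)
      have "compact (P ` D)"
        using D(1) lin by (intro compact_continuous_image linear_continuous_on) (auto simp: linear_conv_bounded_linear)
      moreover have "dim (P ` D) \<le> n"
      proof -
        have "P ` D \<subseteq> span D" using u(1) unfolding P_def
          by (blast intro: span_diff span_scale span_base)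
        then have "span (P ` D) \<subseteq> span D" by (simp add: span_minimal)
        \<comment> \<open>The projection loses the direction \<open>u\<close>, so the dimension
          drops by at least one and the induction hypothesis applies to the image.\<close>
        moreover have "u \<notin> span (P ` D)"
        proof
          assume "u \<in> span (P ` D)"
          moreover have "span (P ` D) \<subseteq> {x. x \<bullet> u = 0}"
            using orth by (intro span_minimal) (auto simp: subspace_def inner_add_left)
          ultimately show False using False by auto
        qed
        moreover have "u \<in> span D" using u(1) by (simp add: span_base)
        ultimately have "span (P ` D) \<subset> span D" by blast
        then show ?thesis using dim_psubset[of "P ` D" D] D(3) by linarith
      qed
      ultimately obtain v where v: "\<And>i. i < n \<Longrightarrow> v i \<in> P ` D"
        "\<And>x. x \<in> P ` D \<Longrightarrow> \<exists>a. (\<forall>i<n. \<bar>a i\<bar> \<le> A) \<and> x = (\<Sum>i<n. a i *\<^sub>R v i)"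
        using IH[of "P ` D"] D(2) by blast
      have "\<forall>i. \<exists>w. i < n \<longrightarrow> w \<in> D \<and> v i = P w" using v(1) by blast
      then obtain w where w: "\<And>i. i < n \<Longrightarrow> w i \<in> D \<and> v i = P (w i)" by metis
      have "\<exists>a. (\<forall>i<Suc n. \<bar>a i\<bar> \<le> A') \<and> x = (\<Sum>i<Suc n. a i *\<^sub>R (if i < n then w i else u))"
        if x: "x \<in> D" for x
      proof -
        obtain a where a: "\<And>i. i < n \<Longrightarrow> \<bar>a i\<bar> \<le> A" "P x = (\<Sum>i<n. a i *\<^sub>R v i)"
          using v(2)[of "P x"] x by blast
        \<comment> \<open>\<open>P\<close> kills this remainder, so it is a multiple of
          \<open>u\<close>. As \<open>u\<close> has maximal norm in \<open>D\<close>, it bounds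
          \<open>x\<close> and every \<open>w i\<close>, hence also the coefficient.\<close>
        define y where "y = x - (\<Sum>i<n. a i *\<^sub>R w i)"
        have "P y = P x - (\<Sum>i<n. a i *\<^sub>R P (w i))"
          by (simp add: y_def linear_diff[OF lin] linear_sum[OF lin] linear_scale[OF lin])
        also have "\<dots> = 0" using a(2) w by simp
        finally have y: "y = ((y \<bullet> u) / (u \<bullet> u)) *\<^sub>R u" by (simp add: P_def)
        define b where "b = (y \<bullet> u) / (u \<bullet> u)"
        have "norm y \<le> norm x + (\<Sum>i<n. norm (a i *\<^sub>R w i))"
          unfolding y_def by (rule order_trans[OF norm_triangle_ineq4 add_left_mono[OF norm_sum]])
        also have "\<dots> \<le> norm u + (\<Sum>i<n. A * norm u)"
          using u(2) x a(1) w A unfolding norm_scaleR by (intro add_mono sum_mono mult_mono) auto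
        also have "\<dots> = (1 + real n * A) * norm u" by (simp add: algebra_simps)
        finally have "\<bar>b\<bar> * norm u \<le> (1 + real n * A) * norm u"
          using y by (metis b_def norm_scaleR)
        then have "\<bar>b\<bar> \<le> 1 + real n * A" using False by simp
        then have "\<bar>b\<bar> \<le> A'" using A' by linarith
        moreover have "\<bar>a i\<bar> \<le> A'" if "i < n" for i using a(1)[OF that] A' by linarith
        moreover have "x = (\<Sum>i<n. a i *\<^sub>R w i) + b *\<^sub>R u" using y unfolding b_def y_def by (simp add: algebra_simps)
        ultimately show ?thesis
          by (intro exI[of _ "a(n := b)"]) (auto simp: less_Suc_eq)
      qed
      then show ?thesis
        using w u(1) by (intro exI[of _ "\<lambda>i. if i < n then w i else u"]) auto
    qed
  qed (use A' in auto)
qed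

text \<open>A weak substitute for John's position, in which \<open>R\<close> only has to be
  independent of the body. By \<open>bounded_coordinates\<close>, a translate of \<open>C\<close>
  through the origin contains the simplex on 0 and the \<open>v i\<close>, and lies in the
  parallelepiped of coordinates at most \<open>A\<close>. Mapping the \<open>v i\<close> to an
  orthonormal basis makes both comparison bodies depend on the dimension alone.\<close>

lemma convex_body_affine_position:
  "\<exists>R\<ge>1. \<forall>C::'a::euclidean_space set. convex_body C \<longrightarrow>
     (\<exists>p T. linear T \<and> inj T \<and> ball (0::'a) 1 \<subseteq> T ` ((\<lambda>y. y - p) ` C) \<and> T ` ((\<lambda>y. y - p) ` C) \<subseteq> cball 0 R)"
proof -
  define n where "n = DIM('a)"
  have n: "n > 0" by (simp add: n_def)
  obtain A where A: "A \<ge> 0" and bc: "\<And>D::'a set. compact D \<Longrightarrow> D \<noteq> {} \<Longrightarrow> dim D \<le> n \<Longrightarrow>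
     (\<exists>v. (\<forall>i<n. v i \<in> D) \<and>
       (\<forall>x\<in>D. \<exists>a. (\<forall>i<n. \<bar>a i\<bar> \<le> A) \<and> x = (\<Sum>i<n. a i *\<^sub>R v i)))"
    using bounded_coordinates[where 'a='a, of n] by blast
  obtain e where e: "bij_betw e {..<n} (Basis::'a set)"
    using ex_bij_betw_nat_finite[OF finite_Basis] by (auto simp: n_def atLeast0LessThan)
  have eB: "\<And>i. i < n \<Longrightarrow> e i \<in> Basis" using e by (auto simp: bij_betw_def)
  have ee: "e i \<bullet> e j = (if i = j then 1 else 0)" if "i < n" "j < n" for i j
    using e that eB by (auto simp: inner_Basis bij_betw_def inj_on_def)
  \<comment> \<open>All coordinates of \<open>q\<close> are \<open>1 / (2 * real n)\<close>, so the
    ball of that radius about \<open>q\<close> lies in the standard simplex, and scaling by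
    \<open>2 * real n\<close> makes it a unit ball. \<open>R\<close> bounds the scaled
    parallelepiped together with the shift of the centre; the \<open>+ 1\<close> in it ensures
    \<open>R \<ge> 1\<close>.\<close>
  define q where "q = (\<Sum>i<n. (1 / (2 * real n)) *\<^sub>R e i)"
  define R where "R = 2 * real n * (real n * A + 1) + norm ((2 * real n) *\<^sub>R q)"
  have "R \<ge> 2 * real n * (real n * A + 1)" by (simp add: R_def)
  moreover have "2 * real n * (real n * A + 1) \<ge> 1 * 1" using n A by (intro mult_mono) auto
  ultimately have R1: "R \<ge> 1" by linarith
  have "\<exists>p T. linear T \<and> inj T \<and> ball (0::'a) 1 \<subseteq> T ` ((\<lambda>y. y - p) ` C) \<and> T ` ((\<lambda>y. y - p) ` C) \<subseteq> cball 0 R"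
    if C: "convex_body C" for C :: "'a set"
  proof -
    obtain p0 where p0: "p0 \<in> C" using C interior_subset unfolding convex_body_def by blast
    define D where "D = (\<lambda>y. y - p0) ` C"
    have D: "compact D" "convex D" "0 \<in> D" "interior D \<noteq> {}"
      using C p0 compact_translation_subtract[of C p0] convex_translation_subtract[of C p0]
      by (simp_all add: D_def convex_body_def interior_translation_subtract)
    have spanD: "span D = UNIV"
    proof (rule ccontr)
      assume "span D \<noteq> UNIV"
      then obtain a where "a \<noteq> 0" "span D \<subseteq> {x. a \<bullet> x = 0}"
        using span_not_univ_subset_hyperplane by blast
      then have "interior D \<subseteq> interior {x. a \<bullet> x = 0}"
        using span_superset by (intro interior_mono) blast
      then show False using D(4) interior_hyperplane[OF \<open>a \<noteq> 0\<close>, of 0] by simp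
    qed
    have "dim D \<le> n" by (simp add: n_def dim_subset_UNIV)
    then obtain v where v: "\<And>i. i < n \<Longrightarrow> v i \<in> D"
       "\<And>x. x \<in> D \<Longrightarrow> \<exists>a. (\<forall>i<n. \<bar>a i\<bar> \<le> A) \<and> x = (\<Sum>i<n. a i *\<^sub>R v i)"
      using bc[of D] D by blast
    define L where "L x = (\<Sum>i<n. (x \<bullet> e i) *\<^sub>R v i)" for x
    have linL: "linear L"
      by (rule linearI) (auto simp: L_def inner_add_left scaleR_add_left sum.distrib scaleR_sum_right)
    have coord: "(\<Sum>i<n. a i *\<^sub>R e i) \<bullet> e j = a j" if "j < n" for a j
    proof -
      have "(\<Sum>i<n. a i *\<^sub>R e i) \<bullet> e j = (\<Sum>i<n. if i = j then a i else 0)"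
        unfolding inner_sum_left using ee that by (intro sum.cong) auto
      then show ?thesis using that by (simp add: sum.delta)
    qed
    have Lsum: "L (\<Sum>i<n. a i *\<^sub>R e i) = (\<Sum>i<n. a i *\<^sub>R v i)" for a
      unfolding L_def using coord by (intro sum.cong) auto
    have "D \<subseteq> range L"
    proof
      fix x assume "x \<in> D"
      then obtain a where "x = (\<Sum>i<n. a i *\<^sub>R v i)" using v(2) by blast
      then have "x = L (\<Sum>i<n. a i *\<^sub>R e i)" by (simp only: Lsum)
      then show "x \<in> range L" by (rule range_eqI)
    qed
    \<comment> \<open>\<open>D\<close> has interior points and so spans the space. Hence
      \<open>L\<close>, which sends the orthonormal basis to the \<open>v i\<close>, is onto, and in
      finite dimension it is invertible.\<close>
    then have "span D \<subseteq> range L" using linL by (intro span_minimal) (auto intro: linear_subspace_image simp: subspace_UNIV)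
    then have surjL: "surj L" using spanD by auto
    obtain G where G: "linear G" "\<forall>x. G (L x) = x" "\<forall>x. L (G x) = x"
      using linear_surjective_isomorphism[OF linL surjL] by blast
    define T where "T x = (2 * real n) *\<^sub>R G x" for x
    have linT: "linear T" unfolding T_def using G(1) by (intro linear_compose_scale_right)
    have injT: "inj T"
    proof (rule injI)
      fix a b assume "T a = T b"
      then have "G a = G b" using n by (simp add: T_def)
      then show "a = b" using G(3) by metis
    qed
    define p where "p = p0 + L q"
    have img: "T ` ((\<lambda>y. y - p) ` C) = (\<lambda>y. (2 * real n) *\<^sub>R (G y - q)) ` D"
      unfolding D_def image_image p_def T_def
    proof (rule image_cong[OF refl])
      fix x
      have "G (x - (p0 + L q)) = G ((x - p0) - L q)" by (simp add: algebra_simps)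
      also have "\<dots> = G (x - p0) - q" using G(2) linear_diff[OF G(1)] by metis
      finally show "(2 * real n) *\<^sub>R G (x - (p0 + L q)) = (2 * real n) *\<^sub>R (G (x - p0) - q)" by simp
    qed
    have "ball (0::'a) 1 \<subseteq> (\<lambda>y. (2 * real n) *\<^sub>R (G y - q)) ` D"
    proof
      fix z :: 'a assume z: "z \<in> ball 0 1"
      define z' where "z' = (1 / (2 * real n)) *\<^sub>R z + q"
      have zz: "z = (2 * real n) *\<^sub>R (G (L z') - q)" using n G(2) by (simp add: z'_def)
      have c: "0 \<le> z' \<bullet> e i \<and> z' \<bullet> e i \<le> 1 / real n" if "i < n" for i
      proof -
        have "q \<bullet> e i = 1 / (2 * real n)" unfolding q_def by (rule coord[OF that])
        then have eq: "z' \<bullet> e i = (1 / (2 * real n)) * (z \<bullet> e i + 1)"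
          by (simp add: z'_def inner_add_left algebra_simps add_divide_distrib)
        have le: "\<bar>z \<bullet> e i\<bar> \<le> 1"
          using Basis_le_norm[OF eB[OF that], of z] z by simp
        then have "0 \<le> (1 / (2 * real n)) * (z \<bullet> e i + 1)" by (intro mult_nonneg_nonneg) auto
        moreover have "(1 / (2 * real n)) * (z \<bullet> e i + 1) \<le> (1 / (2 * real n)) * 2"
          using le by (intro mult_left_mono) auto
        ultimately show ?thesis using eq by simp
      qed
      have s: "(\<Sum>i<n. z' \<bullet> e i) \<le> 1"
      proof -
        have "(\<Sum>i<n. z' \<bullet> e i) \<le> (\<Sum>i<n. 1 / real n)" using c by (intro sum_mono) auto
        then show ?thesis using n by simp
      qed
      \<comment> \<open>Index \<open>n\<close> carries the leftover weight on the vertex 0, which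
        turns the coordinate sum into a convex combination.\<close>
      have "L z' = (\<Sum>i\<in>{..n}. (if i < n then z' \<bullet> e i else 1 - (\<Sum>i<n. z' \<bullet> e i)) *\<^sub>R (if i < n then v i else 0))"
        unfolding L_def lessThan_Suc_atMost[symmetric] by simp
      also have "\<dots> \<in> D"
      proof (rule convex_sum)
        show "(\<Sum>i\<in>{..n}. if i < n then z' \<bullet> e i else 1 - (\<Sum>i<n. z' \<bullet> e i)) = 1"
          unfolding lessThan_Suc_atMost[symmetric] by simp
      qed (use D v(1) c s in auto)
      finally show "z \<in> (\<lambda>y. (2 * real n) *\<^sub>R (G y - q)) ` D" using zz by blast
    qed
    moreover have "(\<lambda>y. (2 * real n) *\<^sub>R (G y - q)) ` D \<subseteq> cball 0 R"
    proof (rule image_subsetI)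
      fix y assume "y \<in> D"
      then obtain a where a: "\<And>i. i < n \<Longrightarrow> \<bar>a i\<bar> \<le> A" "y = (\<Sum>i<n. a i *\<^sub>R v i)" using v(2) by blast
      have "G y = (\<Sum>i<n. a i *\<^sub>R e i)" using a(2) Lsum G(2) by metis
      then have "norm (G y) \<le> (\<Sum>i<n. norm (a i *\<^sub>R e i))" by (simp only: norm_sum)
      also have "\<dots> \<le> (\<Sum>i<n. A)" using a(1) eB by (intro sum_mono) simp
      finally have "norm (G y) \<le> real n * A" by simp
      then have "2 * real n * norm (G y) \<le> 2 * real n * (real n * A + 1)"
        by (intro mult_left_mono) auto
      moreover have "norm ((2 * real n) *\<^sub>R (G y - q)) \<le> 2 * real n * norm (G y) + norm ((2 * real n) *\<^sub>R q)"
        unfolding scaleR_diff_right by (rule order_trans[OF norm_triangle_ineq4]) simp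
      ultimately show "(2 * real n) *\<^sub>R (G y - q) \<in> cball 0 R" by (simp add: R_def)
    qed
    ultimately show ?thesis using linT injT img by (intro exI[of _ p] exI[of _ T]) simp
  qed
  then show ?thesis using R1 by blast
qed

section \<open>Homothets meeting a smaller one\<close>

text \<open>Copies are indexed by the image \<open>x\<close> of the origin because the covering
  argument attaches one to each point; if \<open>0 \<in> K\<close>, that point lies in its own
  copy.\<close>

definition scaled_copy :: "'a::real_vector set \<Rightarrow> 'a \<Rightarrow> real \<Rightarrow> 'a set" where
  "scaled_copy K x r = (\<lambda>y. x + r *\<^sub>R y) ` K"

lemma mem_scaled_copy_iff:
  assumes "r > 0"
  shows "z \<in> scaled_copy K x r \<longleftrightarrow> (1/r) *\<^sub>R (z - x) \<in> K"
proof
  assume "(1/r) *\<^sub>R (z - x) \<in> K"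
  moreover have "z = x + r *\<^sub>R ((1/r) *\<^sub>R (z - x))" using assms by simp
  ultimately show "z \<in> scaled_copy K x r" unfolding scaled_copy_def by blast
qed (use assms in \<open>auto simp: scaled_copy_def\<close>)

text \<open>Cover the ball of radius \<open>A\<close> by finitely many balls of radius
  \<open>d/2\<close>; each of them contains at most one of the separated points.\<close>

lemma separated_card_bound:
  fixes A d :: real
  assumes "d > 0"
  shows "\<exists>N. \<forall>(J::nat set) (y::nat \<Rightarrow> 'a::euclidean_space).
           (\<forall>i\<in>J. norm (y i) \<le> A) \<longrightarrow> (\<forall>i\<in>J. \<forall>j\<in>J. i < j \<longrightarrow> d \<le> dist (y i) (y j)) \<longrightarrow>
           finite J \<and> card J \<le> N"
proof -
  have "compact (cball (0::'a) A)" by simp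
  then obtain Q where Q: "finite Q" "cball (0::'a) A \<subseteq> (\<Union>q\<in>Q. ball q (d/2))"
    using assms unfolding compact_eq_totally_bounded by (meson half_gt_zero)
  show ?thesis
  proof (intro exI[of _ "card Q"] allI impI)
    fix J :: "nat set" and y :: "nat \<Rightarrow> 'a"
    assume b: "\<forall>i\<in>J. norm (y i) \<le> A" and s: "\<forall>i\<in>J. \<forall>j\<in>J. i < j \<longrightarrow> d \<le> dist (y i) (y j)"
    have "\<forall>i\<in>J. \<exists>q\<in>Q. dist q (y i) < d/2"
      using Q(2) b by (fastforce simp: subset_iff)
    then obtain g where g: "\<And>i. i \<in> J \<Longrightarrow> g i \<in> Q \<and> dist (g i) (y i) < d/2" by metis
    have ne: "g i \<noteq> g j" if "i \<in> J" "j \<in> J" "i < j" for i j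
    proof
      assume "g i = g j"
      then have "dist (y i) (y j) < d/2 + d/2"
        using g[OF that(1)] g[OF that(2)] dist_triangle3[of "y i" "y j" "g i"] by simp
      then show False using s that by fastforce
    qed
    have "inj_on g J"
      by (rule linorder_inj_onI') (use ne in auto)
    moreover have "g ` J \<subseteq> Q" using g by blast
    ultimately show "finite J \<and> card J \<le> card Q"
      using Q(1) by (meson card_inj_on_le inj_on_finite)
  qed
qed

text \<open>The copy of \<open>K\<close> about \<open>y\<close> of radius \<open>s\<close> contains
  \<open>p\<close>, which is near the origin, and the ball of radius \<open>s\<close> about
  \<open>y\<close>, hence their convex hull. A point \<open>z\<close> no longer than
  \<open>y\<close> and pointing almost the same way falls into this hull once it is far out compared
  with \<open>p\<close>.\<close>

lemma same_direction_in_convex: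
  fixes K :: "'a::euclidean_space set"
  assumes "convex K" "ball 0 1 \<subseteq> K" "R \<ge> 1" "0 < s"
    and "norm p \<le> R" "(1/s) *\<^sub>R (p - y) \<in> K"
    and "norm y \<le> 2 * R * s" "norm z > 4 * R\<^sup>2" "norm z \<le> norm y"
    and "dist (z /\<^sub>R norm z) (y /\<^sub>R norm y) < 1 / (4 * R)"
  shows "(1/s) *\<^sub>R (z - y) \<in> K"
proof -
  have R2: "R\<^sup>2 \<ge> 1" using assms by (simp add: one_le_power)
  have z0: "norm z > 0" using assms(8) R2 by linarith
  have y0: "norm y > 0" using z0 assms(9) by linarith
  define t where "t = norm z / norm y"
  have t: "0 < t" "t \<le> 1" using z0 y0 assms(9) by (auto simp: t_def)
  \<comment> \<open>Chosen so that \<open>(1/s) *\<^sub>R (z - y)\<close> is the combination of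
    \<open>(1/s) *\<^sub>R (p - y)\<close> and \<open>w\<close> with weights \<open>1-t\<close> and
    \<open>t\<close>; what remains is \<open>norm w < 1\<close>.\<close>
  define w where "w = (1 / (t * s)) *\<^sub>R ((z - t *\<^sub>R y) - (1-t) *\<^sub>R p)"
  have "z - t *\<^sub>R y = norm z *\<^sub>R (z /\<^sub>R norm z - y /\<^sub>R norm y)"
    using z0 y0 by (simp add: t_def algebra_simps divide_inverse)
  then have n1: "norm (z - t *\<^sub>R y) < norm z * (1/(4*R))"
    using mult_strict_left_mono[OF assms(10) z0] by (simp add: dist_norm)
  have "norm ((1-t) *\<^sub>R p) \<le> 1 * R"
    unfolding norm_scaleR using t assms(5) by (intro mult_mono) auto
  then have "norm ((z - t *\<^sub>R y) - (1-t) *\<^sub>R p) < norm z * (1/(4*R)) + R"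
    using n1 norm_triangle_ineq4[of "z - t *\<^sub>R y" "(1-t) *\<^sub>R p"] by linarith
  \<comment> \<open>The threshold \<open>4 * R\<^sup>2\<close> keeps the contribution of
    \<open>p\<close> below \<open>norm z / (4*R)\<close>, the bound for the angular error. The bound
    on \<open>norm y\<close> then compares their sum with \<open>t * s\<close>.\<close>
  also have "R < norm z * (1/(4*R))"
    using assms(3,8) by (simp add: field_simps power2_eq_square)
  then have "norm z * (1/(4*R)) + R \<le> norm z / (2*R)" using assms(3) by (simp add: field_simps)
  also have "norm z / (2*R) \<le> t * s"
    using assms(3,7) y0 z0 by (simp add: t_def field_simps)
  finally have "norm w < 1"
    using t assms(4) by (simp add: w_def)
  then have wK: "w \<in> K" using assms(2) by auto
  have "(1/s) *\<^sub>R (z - y) = (1-t) *\<^sub>R ((1/s) *\<^sub>R (p - y)) + t *\<^sub>R w"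
  proof -
    have "t *\<^sub>R w = (1/s) *\<^sub>R ((z - t *\<^sub>R y) - (1-t) *\<^sub>R p)"
      using t by (simp add: w_def)
    then have "(1-t) *\<^sub>R ((1/s) *\<^sub>R (p - y)) + t *\<^sub>R w
       = (1/s) *\<^sub>R ((1-t) *\<^sub>R (p - y) + ((z - t *\<^sub>R y) - (1-t) *\<^sub>R p))"
      by (simp only: scaleR_add_right scaleR_left_commute)
    also have "(1-t) *\<^sub>R (p - y) + ((z - t *\<^sub>R y) - (1-t) *\<^sub>R p) = z - y"
      by (simp add: algebra_simps)
    finally show ?thesis by simp
  qed
  also have "\<dots> \<in> K"
    using t by (intro convexD[OF assms(1,6) wK]) auto
  finally show ?thesis .
qed

text \<open>
  Split the indices into finitely many classes by the direction of \<open>y\<close>. Within a class the norms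
  increase with the index by the previous lemma, and they stay below \<open>4R\<close> times the first norm
  because the radii at most double; so the class is a separated set in a ball.
\<close>

lemma far_homothets_card_bound:
  fixes R :: real
  assumes R: "R \<ge> 1"
  shows "\<exists>N. \<forall>(K::'a::euclidean_space set) (J::nat set) y s.
     convex K \<longrightarrow> ball 0 1 \<subseteq> K \<longrightarrow> finite J \<longrightarrow>
     (\<forall>j\<in>J. s j > 4 * R\<^sup>2 \<and> s j \<le> norm (y j) \<and> norm (y j) \<le> 2 * R * s j \<and>
        (\<exists>p. norm p \<le> R \<and> (1 / s j) *\<^sub>R (p - y j) \<in> K)) \<longrightarrow>
     (\<forall>j\<in>J. \<forall>i\<in>J. j < i \<longrightarrow> s i \<le> 2 * s j \<and> s j \<le> dist (y j) (y i) \<and> (1 / s j) *\<^sub>R (y i - y j) \<notin> K) \<longrightarrow>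
     card J \<le> N"
proof -
  have d: "1 / (2*R) > 0" using R by simp
  \<comment> \<open>Radius and separation of the centres in one class after division by their
    smallest norm.\<close>
  obtain N2 where N2: "\<And>(J::nat set) (y::nat \<Rightarrow> 'a).
           (\<forall>i\<in>J. norm (y i) \<le> 4 * R) \<Longrightarrow> (\<forall>i\<in>J. \<forall>j\<in>J. i < j \<longrightarrow> 1 / (2*R) \<le> dist (y i) (y j)) \<Longrightarrow>
           finite J \<and> card J \<le> N2"
    using separated_card_bound[OF d, of "4*R"] by metis
  have "compact (cball (0::'a) 1)" by simp
  moreover have "1 / (8*R) > 0" using R by simp
  \<comment> \<open>Two directions within \<open>1 / (8*R)\<close> of the same \<open>q\<close>
    differ by less than \<open>1 / (4*R)\<close>, the tolerance of
    \<open>same_direction_in_convex\<close>.\<close>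
  ultimately obtain Q where Q: "finite Q" "cball (0::'a) 1 \<subseteq> (\<Union>q\<in>Q. ball q (1 / (8*R)))"
    unfolding compact_eq_totally_bounded by meson
  show ?thesis
  proof (intro exI[of _ "card Q * N2"] allI impI)
    fix K :: "'a set" and J :: "nat set" and y :: "nat \<Rightarrow> 'a" and s :: "nat \<Rightarrow> real"
    assume K: "convex K" "ball 0 1 \<subseteq> K" and J: "finite J"
      and a: "\<forall>j\<in>J. s j > 4 * R\<^sup>2 \<and> s j \<le> norm (y j) \<and> norm (y j) \<le> 2 * R * s j \<and>
        (\<exists>p. norm p \<le> R \<and> (1 / s j) *\<^sub>R (p - y j) \<in> K)"
      and b: "\<forall>j\<in>J. \<forall>i\<in>J. j < i \<longrightarrow> s i \<le> 2 * s j \<and> s j \<le> dist (y j) (y i) \<and> (1 / s j) *\<^sub>R (y i - y j) \<notin> K"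
    have R2: "R\<^sup>2 \<ge> 1" using R by (simp add: one_le_power)
    define cls where "cls q = {j\<in>J. dist q (y j /\<^sub>R norm (y j)) < 1 / (8*R)}" for q
    have "J \<subseteq> (\<Union>q\<in>Q. cls q)"
    proof
      fix j assume "j \<in> J"
      have "y j /\<^sub>R norm (y j) \<in> cball 0 1" by (cases "y j = 0") auto
      then obtain q where "q \<in> Q" "y j /\<^sub>R norm (y j) \<in> ball q (1 / (8*R))" using Q(2) by blast
      then show "j \<in> (\<Union>q\<in>Q. cls q)" using \<open>j \<in> J\<close> unfolding cls_def mem_ball by blast
    qed
    moreover have "card (cls q) \<le> N2" for q
    proof (cases "cls q = {}")
      case True
      then show ?thesis by simp
    next
      case False
      have fin: "finite (cls q)" using J by (simp add: cls_def)
      define f where "f = Min (cls q)"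
      have f: "f \<in> cls q" "\<And>i. i \<in> cls q \<Longrightarrow> f \<le> i" using fin False by (auto simp: f_def)
      have fJ: "f \<in> J" using f(1) by (simp add: cls_def)
      have sub: "\<And>i. i \<in> cls q \<Longrightarrow> i \<in> J" by (simp add: cls_def)
      have sf: "s f > 0" "s f \<le> norm (y f)" using bspec[OF a fJ] R2 by linarith+
      then have yf: "norm (y f) > 0" by linarith
      have inc: "norm (y j) < norm (y i)" if "j \<in> cls q" "i \<in> cls q" "j < i" for i j
      proof (rule ccontr)
        assume "\<not> ?thesis"
        then have le: "norm (y i) \<le> norm (y j)" by simp
        have di: "dist (y i /\<^sub>R norm (y i)) (y j /\<^sub>R norm (y j)) < 1 / (8*R) + 1 / (8*R)"
          using that dist_triangle3[of "y i /\<^sub>R norm (y i)" "y j /\<^sub>R norm (y j)" q]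
          unfolding cls_def by auto
        have J': "j \<in> J" "i \<in> J" using that sub by auto
        obtain p where p: "norm p \<le> R" "(1 / s j) *\<^sub>R (p - y j) \<in> K" using a J' by blast
        have "(1 / s j) *\<^sub>R (y i - y j) \<in> K"
        proof (rule same_direction_in_convex[OF K R _ p _ _ le])
          show "0 < s j" "norm (y j) \<le> 2 * R * s j" using bspec[OF a J'(1)] R2 by linarith+
          show "4 * R\<^sup>2 < norm (y i)" using bspec[OF a J'(2)] by linarith
          show "dist (y i /\<^sub>R norm (y i)) (y j /\<^sub>R norm (y j)) < 1 / (4 * R)" using di by simp
        qed
        then show False using b J' that by blast
      qed
      have inc': "norm (y f) \<le> norm (y i)" if "i \<in> cls q" for i
        using inc[OF f(1) that] f(2)[OF that] by (cases "i = f") auto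
      have "card (cls q) \<le> N2"
      proof (rule conjunct2[OF N2[of _ "\<lambda>i. (1 / norm (y f)) *\<^sub>R y i"]])
        show "\<forall>i\<in>cls q. norm ((1 / norm (y f)) *\<^sub>R y i) \<le> 4 * R"
        proof
          fix i assume i: "i \<in> cls q"
          have "s i \<le> 2 * s f" using b fJ sub[OF i] f(2)[OF i] sf by (cases "i = f") auto
          then have "s i \<le> 2 * norm (y f)" using sf by linarith
          moreover have "norm (y i) \<le> 2 * R * s i" using a sub[OF i] by auto
          ultimately have "norm (y i) \<le> 2 * R * (2 * norm (y f))"
            using R by (smt (verit) mult_left_mono)
          then show "norm ((1 / norm (y f)) *\<^sub>R y i) \<le> 4 * R" using yf by (simp add: field_simps)
        qed
        show "\<forall>i\<in>cls q. \<forall>j\<in>cls q. i < j \<longrightarrow>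
          1 / (2*R) \<le> dist ((1 / norm (y f)) *\<^sub>R y i) ((1 / norm (y f)) *\<^sub>R y j)"
        proof (intro ballI impI)
          fix i j assume ij: "i \<in> cls q" "j \<in> cls q" "i < j"
          have "norm (y f) \<le> 2 * R * s i" using inc'[OF ij(1)] bspec[OF a sub[OF ij(1)]] by linarith
          moreover have "s i \<le> dist (y i) (y j)" using b ij sub by blast
          ultimately have "norm (y f) \<le> 2 * R * dist (y i) (y j)"
            using R by (smt (verit) mult_left_mono)
          then show "1 / (2*R) \<le> dist ((1 / norm (y f)) *\<^sub>R y i) ((1 / norm (y f)) *\<^sub>R y j)"
            using yf R unfolding dist_norm scaleR_diff_right[symmetric] norm_scaleR by (simp add: field_simps)
        qed
      qed
      then show ?thesis .
    qed
    ultimately show "card J \<le> card Q * N2"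
    proof -
      assume s: "J \<subseteq> (\<Union>q\<in>Q. cls q)" and c: "\<And>q. card (cls q) \<le> N2"
      have "card J \<le> card (\<Union>q\<in>Q. cls q)"
        using s J Q(1) by (intro card_mono) (auto simp: cls_def)
      also have "\<dots> \<le> (\<Sum>q\<in>Q. card (cls q))" using Q(1) by (rule card_UN_le)
      also have "\<dots> \<le> (\<Sum>q\<in>Q. N2)" by (intro sum_mono c)
      finally show ?thesis by simp
    qed
  qed
qed

text \<open>Rescale so that the latest copy has centre 0 and radius 1; the earlier ones then have
  radius at least \<open>1/2\<close>. Those of bounded radius that meet it have separated centres in
  a bounded ball. Those of large radius are controlled through the directions of their
  centres.\<close>

lemma intersecting_earlier_card_bound:
  fixes R :: real
  assumes R: "R \<ge> 1"
  shows "\<exists>N. \<forall>(K::'a::euclidean_space set) x r (m::nat).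
     convex K \<longrightarrow> ball 0 1 \<subseteq> K \<longrightarrow> K \<subseteq> cball 0 R \<longrightarrow> (\<forall>i\<le>m. r i > 0) \<longrightarrow>
     (\<forall>i j. i < j \<longrightarrow> j \<le> m \<longrightarrow> r j \<le> 2 * r i \<and> x j \<notin> scaled_copy K (x i) (r i)) \<longrightarrow>
     card {i. i < m \<and> scaled_copy K (x i) (r i) \<inter> scaled_copy K (x m) (r m) \<noteq> {}} \<le> N"
proof -
  obtain N1 where N1: "\<And>(J::nat set) (y::nat \<Rightarrow> 'a).
           (\<forall>i\<in>J. norm (y i) \<le> R * (4 * R\<^sup>2 + 1)) \<Longrightarrow> (\<forall>i\<in>J. \<forall>j\<in>J. i < j \<longrightarrow> 1/2 \<le> dist (y i) (y j)) \<Longrightarrow>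
           finite J \<and> card J \<le> N1"
    using separated_card_bound[of "1/2" "R * (4 * R\<^sup>2 + 1)"] by (metis half_gt_zero_iff zero_less_one)
  obtain N2 where N2: "\<And>(K::'a set) (J::nat set) y s.
     convex K \<Longrightarrow> ball 0 1 \<subseteq> K \<Longrightarrow> finite J \<Longrightarrow>
     (\<forall>j\<in>J. s j > 4 * R\<^sup>2 \<and> s j \<le> norm (y j) \<and> norm (y j) \<le> 2 * R * s j \<and>
        (\<exists>p. norm p \<le> R \<and> (1 / s j) *\<^sub>R (p - y j) \<in> K)) \<Longrightarrow>
     (\<forall>j\<in>J. \<forall>i\<in>J. j < i \<longrightarrow> s i \<le> 2 * s j \<and> s j \<le> dist (y j) (y i) \<and> (1 / s j) *\<^sub>R (y i - y j) \<notin> K) \<Longrightarrow>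
     card J \<le> N2"
    using far_homothets_card_bound[where 'a='a, OF R] by metis
  show ?thesis
  proof (intro exI[of _ "N1 + N2"] allI impI)
    fix K :: "'a set" and x r and m :: nat
    assume K: "convex K" "ball 0 1 \<subseteq> K" "K \<subseteq> cball 0 R" and r: "\<forall>i\<le>m. r i > 0"
      and sep: "\<forall>i j. i < j \<longrightarrow> j \<le> m \<longrightarrow> r j \<le> 2 * r i \<and> x j \<notin> scaled_copy K (x i) (r i)"
    define J where "J = {i. i < m \<and> scaled_copy K (x i) (r i) \<inter> scaled_copy K (x m) (r m) \<noteq> {}}"
    have finJ: "finite J" by (simp add: J_def)
    define y where "y i = (1 / r m) *\<^sub>R (x i - x m)" for i
    define s where "s i = r i / r m" for i
    have rm: "r m > 0" using r by simp
    have resc: "(1 / s i) *\<^sub>R ((1 / r m) *\<^sub>R (z - x m) - y i) = (1 / r i) *\<^sub>R (z - x i)" for z i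
      using rm unfolding y_def s_def scaleR_diff_right[symmetric] by simp
    have out: "(1 / s i) *\<^sub>R (y j - y i) \<notin> K" if "i < j" "j \<le> m" for i j
    proof -
      have "r i > 0" using r that by simp
      then show ?thesis
        using sep that resc[of i "x j"] mem_scaled_copy_iff[of "r i" "x j" K "x i"] by (simp add: y_def)
    qed
    have s0: "s i > 0" if "i \<le> m" for i using r rm that by (simp add: s_def)
    \<comment> \<open>\<open>K\<close> contains the unit ball, so a centre outside an earlier copy
      is at least the radius of that copy away from its centre.\<close>
    have dst: "s i \<le> dist (y i) (y j)" if "i < j" "j \<le> m" for i j
    proof -
      have "(1 / s i) *\<^sub>R (y j - y i) \<notin> ball 0 1" using out[OF that] K(2) by blast
      then have "1 \<le> norm (y j - y i) / s i" using s0[of i] that by simp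
      then show ?thesis using s0[of i] that by (simp add: dist_norm norm_minus_commute field_simps)
    qed
    have s2: "s j \<le> 2 * s i" if "i < j" "j \<le> m" for i j
      using sep that rm by (simp add: s_def field_simps)
    have low: "s i \<le> norm (y i)" if "i < m" for i
      using dst[of i m] that by (simp add: y_def)
    have half: "1/2 \<le> s i" if "i < m" for i
      using s2[of i m] that rm by (simp add: s_def)
    \<comment> \<open>\<open>p\<close> is a common point of the two copies after rescaling: it lies
      in \<open>K\<close>, so within \<open>R\<close> of the origin, and in copy \<open>i\<close>,
      so within \<open>R * s i\<close> of \<open>y i\<close>.\<close>
    have meet: "\<exists>p. norm p \<le> R \<and> (1 / s i) *\<^sub>R (p - y i) \<in> K" and up: "norm (y i) \<le> R * (s i + 1)"
      if iJ: "i \<in> J" for i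
    proof -
      have im: "i < m" "r i > 0" using iJ r by (auto simp: J_def)
      obtain z where "z \<in> scaled_copy K (x i) (r i)" "z \<in> scaled_copy K (x m) (r m)"
        using iJ by (auto simp: J_def)
      then have z: "(1 / r i) *\<^sub>R (z - x i) \<in> K" "(1 / r m) *\<^sub>R (z - x m) \<in> K"
        using mem_scaled_copy_iff im rm by blast+
      define p where "p = (1 / r m) *\<^sub>R (z - x m)"
      have p: "norm p \<le> R" "(1 / s i) *\<^sub>R (p - y i) \<in> K"
        using z K(3) resc[of i z] by (auto simp: p_def)
      then show "\<exists>p. norm p \<le> R \<and> (1 / s i) *\<^sub>R (p - y i) \<in> K" by blast
      have "norm ((1 / s i) *\<^sub>R (p - y i)) \<le> R" using p(2) K(3) by auto
      then have "norm (p - y i) / s i \<le> R" using s0[of i] im by simp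
      then have "norm (p - y i) \<le> R * s i" using s0[of i] im by (simp add: pos_divide_le_eq)
      then show "norm (y i) \<le> R * (s i + 1)"
        using p(1) norm_triangle_sub[of "y i" p] by (simp add: algebra_simps norm_minus_commute)
    qed
    \<comment> \<open>The cut is the threshold of \<open>far_homothets_card_bound\<close>. Beyond it
      \<open>s i \<ge> 1\<close>, so \<open>R * (s i + 1)\<close> is at most
      \<open>2 * R * s i\<close>.\<close>
    define J1 where "J1 = {i\<in>J. s i \<le> 4 * R\<^sup>2}"
    define J2 where "J2 = {i\<in>J. s i > 4 * R\<^sup>2}"
    have JJ: "J = J1 \<union> J2" by (auto simp: J1_def J2_def)
    have lt: "\<And>i. i \<in> J \<Longrightarrow> i < m" by (simp add: J_def)
    have "card J1 \<le> N1"
    proof (rule conjunct2[OF N1])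
      show "\<forall>i\<in>J1. norm (y i) \<le> R * (4 * R\<^sup>2 + 1)"
      proof
        fix i assume "i \<in> J1"
        then have i: "i \<in> J" "s i \<le> 4 * R\<^sup>2" by (auto simp: J1_def)
        have "R * (s i + 1) \<le> R * (4 * R\<^sup>2 + 1)" using i(2) R by (intro mult_left_mono) auto
        then show "norm (y i) \<le> R * (4 * R\<^sup>2 + 1)" using up[OF i(1)] by linarith
      qed
      show "\<forall>i\<in>J1. \<forall>j\<in>J1. i < j \<longrightarrow> 1/2 \<le> dist (y i) (y j)"
      proof (intro ballI impI)
        fix i j assume "i \<in> J1" "j \<in> J1" "i < j"
        then show "1/2 \<le> dist (y i) (y j)"
          using half[of i] dst[of i j] lt[of i] lt[of j] by (simp add: J1_def)
      qed
    qed
    moreover have "card J2 \<le> N2"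
    proof (rule N2[OF K(1,2)])
      show "finite J2" using finJ by (simp add: J2_def)
      show "\<forall>j\<in>J2. s j > 4 * R\<^sup>2 \<and> s j \<le> norm (y j) \<and> norm (y j) \<le> 2 * R * s j \<and>
        (\<exists>p. norm p \<le> R \<and> (1 / s j) *\<^sub>R (p - y j) \<in> K)"
      proof
        fix j assume "j \<in> J2"
        then have j: "j \<in> J" "s j > 4 * R\<^sup>2" by (auto simp: J2_def)
        have "R\<^sup>2 \<ge> 1" using R by simp
        then have "s j \<ge> 1" using j by linarith
        then have "R * (s j + 1) \<le> R * (2 * s j)" using R by (intro mult_left_mono) auto
        then have "norm (y j) \<le> 2 * R * s j" using up[OF j(1)] by (simp add: algebra_simps)
        then show "s j > 4 * R\<^sup>2 \<and> s j \<le> norm (y j) \<and> norm (y j) \<le> 2 * R * s j \<and>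
          (\<exists>p. norm p \<le> R \<and> (1 / s j) *\<^sub>R (p - y j) \<in> K)"
          using j meet[OF j(1)] low[OF lt[OF j(1)]] by blast
      qed
      show "\<forall>j\<in>J2. \<forall>i\<in>J2. j < i \<longrightarrow> s i \<le> 2 * s j \<and> s j \<le> dist (y j) (y i) \<and> (1 / s j) *\<^sub>R (y i - y j) \<notin> K"
      proof (intro ballI impI)
        fix j i assume "j \<in> J2" "i \<in> J2" "j < i"
        then have "j < i" "i \<le> m" using lt[of i] by (auto simp: J2_def)
        then show "s i \<le> 2 * s j \<and> s j \<le> dist (y j) (y i) \<and> (1 / s j) *\<^sub>R (y i - y j) \<notin> K"
          using s2 dst out by blast
      qed
    qed
    ultimately show "card J \<le> N1 + N2"
      using card_Un_le[of J1 J2] unfolding JJ[symmetric] by linarith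
  qed
qed

section \<open>Homothets of prescribed measure\<close>

lemma compact_scaled_copy:
  fixes K :: "'a::euclidean_space set"
  assumes "compact K" shows "compact (scaled_copy K x r)"
  unfolding scaled_copy_def using assms by (intro compact_continuous_image continuous_intros)

lemma scaled_copy_mono:
  fixes K :: "'a::real_vector set"
  assumes "convex K" "0 \<in> K" "0 \<le> s" "s \<le> r"
  shows "scaled_copy K x s \<subseteq> scaled_copy K x r"
proof
  fix z assume "z \<in> scaled_copy K x s"
  then obtain y where y: "y \<in> K" "z = x + s *\<^sub>R y" by (auto simp: scaled_copy_def)
  show "z \<in> scaled_copy K x r"
  proof (cases "r = 0")
    case True
    then show ?thesis using y assms by (auto simp: scaled_copy_def)
  next
    case False
    then have "(s/r) *\<^sub>R y \<in> K"
      using convexD[OF assms(1) y(1) assms(2), of "s/r" "1 - s/r"] assms by simp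
    moreover have "z = x + r *\<^sub>R ((s/r) *\<^sub>R y)" using y False by simp
    ultimately show ?thesis unfolding scaled_copy_def by blast
  qed
qed

text \<open>Compactness of \<open>K\<close> supplies a limit of the preimages of a common point.
  Radius 0 is included since the infimum of radii to which this is applied is not yet known to be
  positive.\<close>

lemma INT_scaled_copy:
  fixes K :: "'a::euclidean_space set"
  assumes "compact K" "convex K" "0 \<in> K" "r \<ge> 0"
  shows "(\<Inter>n. scaled_copy K x (r + 1 / real (Suc n))) = scaled_copy K x r"
proof
  show "scaled_copy K x r \<subseteq> (\<Inter>n. scaled_copy K x (r + 1 / real (Suc n)))"
    using assms by (intro INT_greatest scaled_copy_mono) auto
  show "(\<Inter>n. scaled_copy K x (r + 1 / real (Suc n))) \<subseteq> scaled_copy K x r"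
  proof
    fix z assume "z \<in> (\<Inter>n. scaled_copy K x (r + 1 / real (Suc n)))"
    then have "\<forall>n. \<exists>y\<in>K. z = x + (r + 1 / real (Suc n)) *\<^sub>R y"
      by (auto simp: scaled_copy_def)
    then obtain y where y: "\<And>n. y n \<in> K" "\<And>n. z = x + (r + 1 / real (Suc n)) *\<^sub>R y n"
      by metis
    obtain l \<sigma> where l: "l \<in> K" "strict_mono (\<sigma>::nat\<Rightarrow>nat)" "(y \<circ> \<sigma>) \<longlonglongrightarrow> l"
      using assms(1) y(1) unfolding compact_def by metis
    have "(\<lambda>n. 1 / real (Suc n)) \<longlonglongrightarrow> 0" by (rule lim_1_over_n[THEN LIMSEQ_Suc])
    then have "(\<lambda>n. 1 / real (Suc (\<sigma> n))) \<longlonglongrightarrow> 0"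
      using LIMSEQ_subseq_LIMSEQ[OF _ l(2)] by (fastforce simp: o_def)
    then have "(\<lambda>n. x + (r + 1 / real (Suc (\<sigma> n))) *\<^sub>R y (\<sigma> n)) \<longlonglongrightarrow> x + (r + 0) *\<^sub>R l"
      using l(3) by (intro tendsto_intros) (auto simp: o_def)
    then have "(\<lambda>n. z) \<longlonglongrightarrow> x + (r + 0) *\<^sub>R l" using y(2) by simp
    then have "z = x + r *\<^sub>R l" by (simp add: LIMSEQ_const_iff)
    then show "z \<in> scaled_copy K x r" using l(1) by (auto simp: scaled_copy_def)
  qed
qed

text \<open>An interior point stays in the copy when pushed slightly away from \<open>x\<close>;
  undoing the push places it in a smaller copy. Thus smaller copies exhaust everything except the
  frontier.\<close>

lemma interior_scaled_copy_subset:
  fixes K :: "'a::euclidean_space set"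
  assumes "r > 0"
  shows "interior (scaled_copy K x r) \<subseteq> (\<Union>n. scaled_copy K x (r * (real (Suc n) / real (Suc (Suc n)))))"
proof
  fix z assume z: "z \<in> interior (scaled_copy K x r)"
  have "(\<lambda>n. real (Suc (Suc n)) / real (Suc n)) \<longlonglongrightarrow> 1"
  proof -
    have "(\<lambda>n. 1 + 1 / real (Suc n)) \<longlonglongrightarrow> 1 + 0"
      by (intro tendsto_intros lim_1_over_n[THEN LIMSEQ_Suc])
    moreover have "(\<lambda>n. 1 + 1 / real (Suc n)) = (\<lambda>n. real (Suc (Suc n)) / real (Suc n))"
      by (auto simp: field_simps)
    ultimately show ?thesis by simp
  qed
  then have "(\<lambda>n. x + (real (Suc (Suc n)) / real (Suc n)) *\<^sub>R (z - x)) \<longlonglongrightarrow> x + 1 *\<^sub>R (z - x)"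
    by (intro tendsto_intros)
  then have "\<forall>\<^sub>F n in sequentially. x + (real (Suc (Suc n)) / real (Suc n)) *\<^sub>R (z - x) \<in> interior (scaled_copy K x r)"
    using z by (intro topological_tendstoD) auto
  then obtain n where "x + (real (Suc (Suc n)) / real (Suc n)) *\<^sub>R (z - x) \<in> scaled_copy K x r"
    using interior_subset by (fastforce simp: eventually_sequentially)
  then have "(1/r) *\<^sub>R ((real (Suc (Suc n)) / real (Suc n)) *\<^sub>R (z - x)) \<in> K"
    using assms by (simp only: mem_scaled_copy_iff add_diff_cancel_left')
  moreover have "(1/r) *\<^sub>R ((real (Suc (Suc n)) / real (Suc n)) *\<^sub>R (z - x)) =
     (1 / (r * (real (Suc n) / real (Suc (Suc n))))) *\<^sub>R (z - x)"
    using assms by simp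
  ultimately have "z \<in> scaled_copy K x (r * (real (Suc n) / real (Suc (Suc n))))"
    using assms by (subst mem_scaled_copy_iff) auto
  then show "z \<in> (\<Union>n. scaled_copy K x (r * (real (Suc n) / real (Suc (Suc n)))))" by blast
qed

text \<open>The radius is the infimum of those reaching measure \<open>k\<close>. Continuity from
  above keeps the measure at least \<open>k\<close> there. Continuity from below gives at most
  \<open>k\<close> to the union of smaller copies, and the rest lies in the frontier.\<close>

lemma exists_radius:
  fixes K :: "'a::euclidean_space set" and M :: "'a measure"
  assumes M: "finite_measure M" "sets M = sets borel"
    and K: "compact K" "convex K" "0 \<in> K"
    and "measure M {x} < k" "B > 0" "k \<le> measure M (scaled_copy K x B)"
    and fr: "\<And>s. s > 0 \<Longrightarrow> measure M (frontier (scaled_copy K x s)) \<le> e"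
  shows "\<exists>r. 0 < r \<and> r \<le> B \<and> k \<le> measure M (scaled_copy K x r) \<and> measure M (scaled_copy K x r) \<le> k + e"
proof -
  interpret finite_measure M by fact
  have meas: "scaled_copy K x s \<in> sets M" for s
    using compact_scaled_copy[OF K(1)] M(2) by (simp add: borel_compact)
  define S where "S = {s. 0 < s \<and> k \<le> measure M (scaled_copy K x s)}"
  define r where "r = Inf S"
  have BS: "B \<in> S" using assms by (simp add: S_def)
  have bdd: "bdd_below S" by (auto simp: S_def intro!: bdd_belowI[of _ 0])
  have r0: "0 \<le> r" unfolding r_def using BS by (intro cInf_greatest) (auto simp: S_def)
  have rB: "r \<le> B" unfolding r_def using BS bdd by (simp add: cInf_lower)
  have ge: "k \<le> measure M (scaled_copy K x r)"
  proof (rule LIMSEQ_le_const)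
    have "(\<lambda>n. measure M (scaled_copy K x (r + 1 / real (Suc n)))) \<longlonglongrightarrow>
       measure M (\<Inter>n. scaled_copy K x (r + 1 / real (Suc n)))"
    proof (rule finite_Lim_measure_decseq)
      show "decseq (\<lambda>n. scaled_copy K x (r + 1 / real (Suc n)))"
        unfolding decseq_def using K r0 by (intro allI impI scaled_copy_mono) (auto simp: frac_le)
    qed (use meas in auto)
    then show "(\<lambda>n. measure M (scaled_copy K x (r + 1 / real (Suc n)))) \<longlonglongrightarrow> measure M (scaled_copy K x r)"
      using INT_scaled_copy[OF K r0] by simp
    have "k \<le> measure M (scaled_copy K x (r + 1 / real (Suc n)))" for n
    proof -
      have "Inf S < r + 1 / real (Suc n)" by (simp add: r_def)
      then obtain s where s: "s \<in> S" "s < r + 1 / real (Suc n)"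
        using cInf_less_iff[of S] BS bdd by blast
      then have "measure M (scaled_copy K x s) \<le> measure M (scaled_copy K x (r + 1 / real (Suc n)))"
        using K by (intro finite_measure_mono scaled_copy_mono meas) (auto simp: S_def)
      then show ?thesis using s by (auto simp: S_def)
    qed
    then show "\<exists>N. \<forall>n\<ge>N. k \<le> measure M (scaled_copy K x (r + 1 / real (Suc n)))" by blast
  qed
  \<comment> \<open>At radius 0 the copy is a single point, which is too light by assumption; so the
    infimum is positive.\<close>
  have "scaled_copy K x 0 = {x}" using K by (auto simp: scaled_copy_def)
  then have rpos: "0 < r" using ge assms(6) r0 by (cases "r = 0") auto
  define s where "s n = r * (real (Suc n) / real (Suc (Suc n)))" for n
  have "measure M (\<Union>n. scaled_copy K x (s n)) \<le> k"
  proof (rule LIMSEQ_le_const2)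
    show "(\<lambda>n. measure M (scaled_copy K x (s n))) \<longlonglongrightarrow> measure M (\<Union>n. scaled_copy K x (s n))"
    proof (rule finite_Lim_measure_incseq)
      show "incseq (\<lambda>n. scaled_copy K x (s n))"
        unfolding incseq_def s_def using K rpos
        by (intro allI impI scaled_copy_mono mult_left_mono) (auto simp: field_simps)
    qed (use meas in auto)
    have "measure M (scaled_copy K x (s n)) \<le> k" for n
    proof -
      have "0 < s n" "s n < r" using rpos by (auto simp: s_def field_simps add_pos_nonneg)
      then have "s n \<notin> S" using cInf_lower[OF _ bdd, of "s n"] by (auto simp: r_def)
      then show ?thesis using \<open>0 < s n\<close> by (auto simp: S_def)
    qed
    then show "\<exists>N. \<forall>n\<ge>N. measure M (scaled_copy K x (s n)) \<le> k" by blast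
  qed
  moreover have "measure M (scaled_copy K x r) \<le>
      measure M (\<Union>n. scaled_copy K x (s n)) + measure M (frontier (scaled_copy K x r))"
  proof -
    have f: "frontier (scaled_copy K x r) \<in> sets M" using M(2) by simp
    have U: "(\<Union>n. scaled_copy K x (s n)) \<in> sets M" using meas by blast
    have "scaled_copy K x r \<subseteq> (\<Union>n. scaled_copy K x (s n)) \<union> frontier (scaled_copy K x r)"
      using interior_scaled_copy_subset[OF rpos, of K x] closure_subset[of "scaled_copy K x r"]
      unfolding s_def frontier_def by blast
    then have "measure M (scaled_copy K x r) \<le> measure M ((\<Union>n. scaled_copy K x (s n)) \<union> frontier (scaled_copy K x r))"
      using f U by (intro finite_measure_mono) auto
    also have "\<dots> \<le> measure M (\<Union>n. scaled_copy K x (s n)) + measure M (frontier (scaled_copy K x r))"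
      by (rule measure_Un_le[OF U f])
    finally show ?thesis .
  qed
  ultimately have "measure M (scaled_copy K x r) \<le> k + e" using fr[OF rpos] by linarith
  then show ?thesis using rpos rB ge by blast
qed

section \<open>Greedy selection\<close>

text \<open>A greedy selection of maximal length must cover \<open>X\<close>: otherwise an uncovered
  point with radius above half the supremum over all uncovered points extends it. The factor 2 is
  there because the supremum need not be attained.\<close>

lemma greedy_cover:
  fixes X :: "'a set" and r :: "'a \<Rightarrow> real" and h :: "'a \<Rightarrow> 'a set"
  defines "greedy \<equiv> \<lambda>m x. \<forall>i<m. x i \<in> X \<and> (\<forall>l<i. x i \<notin> h (x l)) \<and>
             (\<forall>z\<in>X. (\<forall>l<i. z \<notin> h (x l)) \<longrightarrow> r z \<le> 2 * r (x i))"
  assumes r: "\<And>z. z \<in> X \<Longrightarrow> 0 < r z \<and> r z \<le> B"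
    and bound: "\<And>m x. greedy m x \<Longrightarrow> m \<le> (N::nat)"
  shows "\<exists>m x. greedy m x \<and> X \<subseteq> (\<Union>i<m. h (x i))"
proof -
  \<comment> \<open>Only the first \<open>m\<close> terms of the sequence matter, so any sequence
    witnesses length 0.\<close>
  have "greedy 0 undefined" by (simp add: greedy_def)
  then have "\<exists>m. (\<exists>x. greedy m x) \<and> (\<forall>m'. (\<exists>x. greedy m' x) \<longrightarrow> m' \<le> m)"
    using ex_has_greatest_nat[of "\<lambda>m. \<exists>x. greedy m x" 0 "\<lambda>m. m" "Suc N"] bound
    by (auto simp: less_Suc_eq_le)
  then obtain m x where g: "greedy m x" and mx: "\<And>m' x'. greedy m' x' \<Longrightarrow> m' \<le> m" by blast
  have "X \<subseteq> (\<Union>i<m. h (x i))"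
  proof (rule ccontr)
    assume nc: "\<not> X \<subseteq> (\<Union>i<m. h (x i))"
    define U where "U = X - (\<Union>i<m. h (x i))"
    have U: "U \<noteq> {}" "U \<subseteq> X" using nc by (auto simp: U_def)
    have bd: "bdd_above (r ` U)" using r U by (auto intro!: bdd_aboveI[of _ B])
    have up: "r z \<le> Sup (r ` U)" if "z \<in> U" for z using bd that by (simp add: cSUP_upper)
    have "0 < Sup (r ` U)" using U r up by (meson ex_in_conv less_le_trans subsetD)
    then obtain z where z: "z \<in> U" "Sup (r ` U) / 2 < r z"
      using less_cSUP_iff[OF U(1) bd, of "Sup (r ` U) / 2"] by auto
    have "greedy (Suc m) (x(m := z))"
      unfolding greedy_def
    proof (intro allI impI)
      fix i assume "i < Suc m"
      then consider "i < m" | "i = m" by linarith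
      then show "(x(m := z)) i \<in> X \<and> (\<forall>l<i. (x(m := z)) i \<notin> h ((x(m := z)) l)) \<and>
             (\<forall>w\<in>X. (\<forall>l<i. w \<notin> h ((x(m := z)) l)) \<longrightarrow> r w \<le> 2 * r ((x(m := z)) i))"
      proof cases
        case 1
        then show ?thesis using g unfolding greedy_def by auto
      next
        case 2
        have "r w \<le> 2 * r z" if "w \<in> X" "\<forall>l<m. w \<notin> h (x l)" for w
          using up[of w] z(2) that by (auto simp: U_def)
        then show ?thesis using 2 z(1) by (auto simp: U_def)
      qed
    qed
    then show False using mx[of "Suc m"] by auto
  qed
  with g show ?thesis by blast
qed

text \<open>Keep the largest vertex and delete it together with its at most \<open>N\<close> smaller
  neighbours: each round costs at most \<open>N+1\<close> vertices and gains one independent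
  vertex.\<close>

lemma degenerate_graph_independent_set:
  fixes E :: "nat \<Rightarrow> nat \<Rightarrow> bool"
  assumes "finite J" "\<And>n. n \<in> J \<Longrightarrow> card {i\<in>J. i < n \<and> E i n} \<le> N"
  shows "\<exists>I\<subseteq>J. card J \<le> (N+1) * card I \<and> (\<forall>i\<in>I. \<forall>j\<in>I. i < j \<longrightarrow> \<not> E i j)"
  using assms
proof (induction J rule: finite_psubset_induct)
  case (psubset J)
  show ?case
  proof (cases "J = {}")
    case True
    then show ?thesis by auto
  next
    case False
    define n where "n = Max J"
    have n: "n \<in> J" "\<And>i. i \<in> J \<Longrightarrow> i \<le> n" using False psubset.hyps by (auto simp: n_def)
    define D where "D = insert n {i\<in>J. i < n \<and> E i n}"
    have D: "D \<subseteq> J" "finite D" "card D \<le> N + 1"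
      using n psubset.hyps psubset.prems[OF n(1)] by (auto simp: D_def card_insert_if)
    have "J - D \<subset> J" using n(1) by (auto simp: D_def)
    moreover have "card {i \<in> J - D. i < m \<and> E i m} \<le> N" if "m \<in> J - D" for m
    proof -
      have "card {i \<in> J - D. i < m \<and> E i m} \<le> card {i\<in>J. i < m \<and> E i m}"
        using psubset.hyps by (intro card_mono) auto
      then show ?thesis using psubset.prems[of m] that by auto
    qed
    ultimately obtain I where I: "I \<subseteq> J - D" "card (J - D) \<le> (N+1) * card I"
      "\<forall>i\<in>I. \<forall>j\<in>I. i < j \<longrightarrow> \<not> E i j"
      using psubset.IH[of "J - D"] by blast
    have fI: "finite I" using I(1) psubset.hyps by (meson finite_Diff finite_subset)
    have nI: "n \<notin> I" using I(1) by (auto simp: D_def)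
    have "card J = card (J - D) + card D"
      using D psubset.hyps by (metis card_Diff_subset card_mono le_add_diff_inverse2)
    then have "card J \<le> (N+1) * card (insert n I)"
      using I(2) D(3) fI nI by simp
    moreover have "\<not> E i j" if "i \<in> insert n I" "j \<in> insert n I" "i < j" for i j
    proof (cases "j = n")
      case True
      then have "i \<in> J - D" "i < n" using that I(1) by auto
      then show ?thesis using True by (auto simp: D_def)
    next
      case False
      then have "j \<in> I" using that by auto
      moreover have "i \<noteq> n" using that n(2)[of j] I(1) \<open>j \<in> I\<close> by auto
      ultimately show ?thesis using that I(3) by auto
    qed
    ultimately show ?thesis using n(1) I(1) by (intro exI[of _ "insert n I"]) auto
  qed
qed

section \<open>Disjoint heavy homothets for a finite measure\<close>

lemma scaled_copy_translate_eq_homothet: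
  "scaled_copy ((\<lambda>y. y - p) ` C) x r = (\<lambda>y. r *\<^sub>R y + (x - r *\<^sub>R p)) ` C"
  unfolding scaled_copy_def image_image by (intro image_cong) (auto simp: algebra_simps)

text \<open>Covering happens in the original space and counting in the normalised one; linear maps
  carry copies to copies with the same radii.\<close>

lemma scaled_copy_linear_image:
  assumes "linear T"
  shows "scaled_copy (T ` K) (T x) r = T ` scaled_copy K x r"
  unfolding scaled_copy_def image_image
  by (intro image_cong) (auto simp: linear_add[OF assms] linear_scale[OF assms])

text \<open>Some translate of \<open>C\<close> has \<open>x\<close> on its boundary. This supplies
  the light centres that \<open>exists_radius\<close> asks for.\<close>

lemma measure_singleton_le_frontier:
  fixes C :: "'a::euclidean_space set"
  assumes "finite_measure M" "sets M = sets borel" "compact C" "C \<noteq> {}"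
    and fr: "\<And>H. H \<in> homothets C \<Longrightarrow> measure M (frontier H) \<le> e"
  shows "measure M {x} \<le> e"
proof -
  interpret finite_measure M by fact
  have "C \<noteq> UNIV" using assms(3) compact_imp_bounded not_bounded_UNIV by blast
  then obtain z where z: "z \<in> frontier C" using frontier_eq_empty assms(4) by blast
  define H where "H = (\<lambda>y. 1 *\<^sub>R y + (x - z)) ` C"
  have H: "H \<in> homothets C" 
    unfolding H_def homothets_def by (intro CollectI exI[of _ 1] exI[of _ "x - z"]) simp
  have "H = (+) (x - z) ` C" unfolding H_def by (intro image_cong) (auto simp: algebra_simps)
  then have "frontier H = (+) (x - z) ` frontier C" by (simp add: frontier_translation)
  moreover have "x = (x - z) + z" by simp
  ultimately have "{x} \<subseteq> frontier H" using z by blast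
  then have "measure M {x} \<le> measure M (frontier H)"
    using assms(2) by (intro finite_measure_mono) auto
  then show ?thesis using fr[OF H] by linarith
qed

text \<open>The common form of both claims: the frontier bound \<open>k / 2\<close> is the
  non-degeneracy of a point set when \<open>M\<close> counts its points, and it holds for nice
  measures because their frontiers are null.\<close>

lemma disjoint_heavy_homothets:
  "\<exists>c>0. \<forall>(C::'a::euclidean_space set) M k w \<rho>.
     convex_body C \<longrightarrow> finite_measure M \<longrightarrow> sets M = sets borel \<longrightarrow> 0 < k \<longrightarrow>
     k \<le> measure M (space M) \<longrightarrow> measure M (cball w \<rho>) = measure M (space M) \<longrightarrow>
     (\<forall>H\<in>homothets C. measure M (frontier H) \<le> k / 2) \<longrightarrow>
     (\<exists>F. finite F \<and> F \<subseteq> homothets C \<and> (\<forall>H\<in>F. k \<le> measure M H) \<and>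
        pairwise_interior_disjoint F \<and> c * measure M (space M) / k \<le> real (card F))"
proof -
  obtain R where R: "R \<ge> 1" and pos: "\<And>C::'a set. convex_body C \<Longrightarrow>
     \<exists>p T. linear T \<and> inj T \<and> ball (0::'a) 1 \<subseteq> T ` ((\<lambda>y. y - p) ` C) \<and> T ` ((\<lambda>y. y - p) ` C) \<subseteq> cball 0 R"
    using convex_body_affine_position[where 'a='a] by blast
  from intersecting_earlier_card_bound[where 'a='a, OF R]
  obtain N where N: "\<forall>(K::'a set) x r (m::nat).
     convex K \<longrightarrow> ball 0 1 \<subseteq> K \<longrightarrow> K \<subseteq> cball 0 R \<longrightarrow> (\<forall>i\<le>m. r i > 0) \<longrightarrow>
     (\<forall>i j. i < j \<longrightarrow> j \<le> m \<longrightarrow> r j \<le> 2 * r i \<and> x j \<notin> scaled_copy K (x i) (r i)) \<longrightarrow>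
     card {i. i < m \<and> scaled_copy K (x i) (r i) \<inter> scaled_copy K (x m) (r m) \<noteq> {}} \<le> N" ..
  \<comment> \<open>A cover by \<open>m\<close> homothets of measure at most \<open>3k/2\<close> has
    \<open>m\<close> at least \<open>2/(3k)\<close> times the total measure, and at least
    \<open>m/(N+1)\<close> of them are pairwise disjoint.\<close>
  define c where "c = 2 / (3 * (real N + 1))"
  show ?thesis
  proof (intro exI[of _ c] conjI allI impI)
    show "c > 0" by (simp add: c_def)
    fix C :: "'a set" and M :: "'a measure" and k w \<rho>
    assume C: "convex_body C" and fM: "finite_measure M" and sM: "sets M = sets borel" and k: "0 < k"
      and kM: "k \<le> measure M (space M)" and ball: "measure M (cball w \<rho>) = measure M (space M)"
      and fr: "\<forall>H\<in>homothets C. measure M (frontier H) \<le> k / 2"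
    interpret finite_measure M by fact
    obtain p T where T: "linear T" "inj T" "ball (0::'a) 1 \<subseteq> T ` ((\<lambda>y. y - p) ` C)"
      "T ` ((\<lambda>y. y - p) ` C) \<subseteq> cball 0 R" using pos[OF C] by blast
    define K where "K = (\<lambda>y. y - p) ` C"
    have K: "compact K" "convex K"
      using C compact_translation_subtract[of C p] convex_translation_subtract[of C p]
      by (simp_all add: K_def convex_body_def)
    have ballK: "y \<in> K" if "norm (T y) < 1" for y
    proof -
      have "T y \<in> T ` K" using T(3) that unfolding K_def[symmetric] by auto
      then show ?thesis using T(2) by (simp add: inj_image_mem_iff)
    qed
    have K0: "0 \<in> K" using ballK[of 0] linear_0[OF T(1)] by simp
    have hom: "scaled_copy K x s \<in> homothets C" if "s > 0" for x s
      using that unfolding K_def scaled_copy_translate_eq_homothet homothets_def by blast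
    have meas: "scaled_copy K x s \<in> sets M" for x s
      using compact_scaled_copy[OF K(1)] sM by (simp add: borel_compact)
    have Cne: "C \<noteq> {}" using C by (auto simp: convex_body_def)
    have sing: "measure M {x} < k" for x
      using measure_singleton_le_frontier[OF fM sM _ Cne, of "k/2" x] fr k C
      by (simp add: convex_body_def)
    define X where "X = cball w \<rho>"
    obtain b where b: "b > 0" "\<And>y. norm (T y) \<le> b * norm y"
      using linear_bounded_pos[OF T(1)] by blast
    \<comment> \<open>Points of \<open>X\<close> differ by at most
      \<open>2 * \<bar>\<rho>\<bar>\<close>, so \<open>T\<close> maps their differences to vectors
      shorter than \<open>B\<close>, and the copy of radius \<open>B\<close> about any of them
      contains \<open>X\<close>. The \<open>+ 1\<close> makes this strict and \<open>B\<close>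
      positive.\<close>
    define B where "B = 2 * b * \<bar>\<rho>\<bar> + 1"
    have B: "B > 0" using b by (simp add: B_def add_nonneg_pos)
    have XB: "X \<subseteq> scaled_copy K x B" if "x \<in> X" for x
    proof
      fix z assume "z \<in> X"
      then have "norm (z - x) \<le> 2 * \<bar>\<rho>\<bar>"
        using that dist_triangle3[of z x w] by (auto simp: X_def dist_norm)
      then have "b * norm (z - x) \<le> b * (2 * \<bar>\<rho>\<bar>)" using b(1) by (intro mult_left_mono) auto
      then have "norm (T (z - x)) < B" using b(2)[of "z - x"] by (simp add: B_def)
      then have "norm (T ((1/B) *\<^sub>R (z - x))) < 1" using B by (simp add: linear_scale[OF T(1)])
      then show "z \<in> scaled_copy K x B" using mem_scaled_copy_iff[OF B] ballK by blast
    qed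
    have "\<exists>r. 0 < r \<and> r \<le> B \<and> k \<le> measure M (scaled_copy K x r) \<and> measure M (scaled_copy K x r) \<le> k + k/2"
      if "x \<in> X" for x
    proof (rule exists_radius[OF fM sM K K0 sing B])
      have "measure M X \<le> measure M (scaled_copy K x B)"
        using XB[OF that] meas by (intro finite_measure_mono)
      then show "k \<le> measure M (scaled_copy K x B)" using kM ball by (simp add: X_def)
    qed (use fr hom in blast)
    then obtain r where r: "\<And>x. x \<in> X \<Longrightarrow> 0 < r x \<and> r x \<le> B"
      "\<And>x. x \<in> X \<Longrightarrow> k \<le> measure M (scaled_copy K x (r x))"
      "\<And>x. x \<in> X \<Longrightarrow> measure M (scaled_copy K x (r x)) \<le> k + k/2" by metis
    define h where "h x = scaled_copy K x (r x)" for x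
    define greedy where "greedy = (\<lambda>(m::nat) x. \<forall>i<m. x i \<in> X \<and> (\<forall>l<i. x i \<notin> h (x l)) \<and>
             (\<forall>z\<in>X. (\<forall>l<i. z \<notin> h (x l)) \<longrightarrow> r z \<le> 2 * r (x i)))"
    have indep: "\<exists>I\<subseteq>{..<m}. m \<le> (N+1) * card I \<and> (\<forall>i\<in>I. \<forall>j\<in>I. i < j \<longrightarrow> h (x i) \<inter> h (x j) = {})"
      if g: "greedy m x" for m x
    proof -
      have "card {i \<in> {..<m}. i < n \<and> h (x i) \<inter> h (x n) \<noteq> {}} \<le> N" if n: "n \<in> {..<m}" for n
      proof -
        \<comment> \<open>The count is made on images under \<open>T\<close>, where the body lies
          between the balls of radius 1 and \<open>R\<close>; injectivity of \<open>T\<close>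
          preserves disjointness and non-membership.\<close>
        have "card {i. i < n \<and> scaled_copy (T ` K) (T (x i)) (r (x i)) \<inter> scaled_copy (T ` K) (T (x n)) (r (x n)) \<noteq> {}} \<le> N"
        proof (rule N[THEN spec, THEN spec, THEN spec, THEN spec, THEN mp, THEN mp, THEN mp, THEN mp, THEN mp,
              of _ _ "\<lambda>i. r (x i)" "\<lambda>i. T (x i)"])
          show "convex (T ` K)" using K(2) T(1) by (simp add: convex_linear_image)
          show "ball 0 1 \<subseteq> T ` K" "T ` K \<subseteq> cball 0 R" using T by (auto simp: K_def)
          show "\<forall>i\<le>n. r (x i) > 0" using g n r(1) unfolding greedy_def by auto
          show "\<forall>i j. i < j \<longrightarrow> j \<le> n \<longrightarrow> r (x j) \<le> 2 * r (x i) \<and> T (x j) \<notin> scaled_copy (T ` K) (T (x i)) (r (x i))"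
          proof (intro allI impI)
            fix i j assume ij: "i < j" "j \<le> n"
            then have "i < m" "j < m" using n by auto
            then have gi: "\<And>z. z \<in> X \<Longrightarrow> \<forall>l<i. z \<notin> h (x l) \<Longrightarrow> r z \<le> 2 * r (x i)"
              and gj: "x j \<in> X" "\<And>l. l < j \<Longrightarrow> x j \<notin> h (x l)"
              using g unfolding greedy_def by blast+
            \<comment> \<open>\<open>x j\<close> avoids everything chosen before \<open>x i\<close>,
              so it was a candidate when \<open>x i\<close> was chosen.\<close>
            have "r (x j) \<le> 2 * r (x i)" using gj ij by (intro gi) auto
            moreover have "x j \<notin> h (x i)" using gj ij by blast
            ultimately show "r (x j) \<le> 2 * r (x i) \<and> T (x j) \<notin> scaled_copy (T ` K) (T (x i)) (r (x i))"
              unfolding scaled_copy_linear_image[OF T(1)] h_def using T(2) by (simp add: inj_image_mem_iff)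
          qed
        qed
        moreover have "{i \<in> {..<m}. i < n \<and> h (x i) \<inter> h (x n) \<noteq> {}} =
          {i. i < n \<and> scaled_copy (T ` K) (T (x i)) (r (x i)) \<inter> scaled_copy (T ` K) (T (x n)) (r (x n)) \<noteq> {}}"
          unfolding scaled_copy_linear_image[OF T(1)] h_def image_Int[OF T(2), symmetric] using n by auto
        ultimately show ?thesis by simp
      qed
      then show ?thesis
        using degenerate_graph_independent_set[of "{..<m}" "\<lambda>i j. h (x i) \<inter> h (x j) \<noteq> {}" N] by auto
    qed
    have hX: "h (x i) \<in> sets M" for x :: "nat \<Rightarrow> 'a" and i using meas by (simp add: h_def)
    have disj: "disjoint_family_on (\<lambda>i. h (x i)) I"
      if "\<forall>i\<in>I. \<forall>j\<in>I. i < j \<longrightarrow> h (x i) \<inter> h (x j) = {}" for x and I :: "nat set"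
      unfolding disjoint_family_on_def
    proof (intro ballI impI)
      fix i j assume ij: "i \<in> I" "j \<in> I" "i \<noteq> j"
      then consider "i < j" | "j < i" by linarith
      then show "h (x i) \<inter> h (x j) = {}" using that ij by cases blast+
    qed
    \<comment> \<open>At most \<open>measure M (space M) / k\<close> disjoint sets have measure at
      least \<open>k\<close>. Since a fraction \<open>1/(N+1)\<close> of any greedy selection is
      disjoint, its length is bounded.\<close>
    have bound: "m \<le> nat \<lceil>(real N + 1) * (measure M (space M) / k)\<rceil>" if g: "greedy m x" for m x
    proof -
      obtain I where I: "I \<subseteq> {..<m}" "m \<le> (N+1) * card I"
        "\<forall>i\<in>I. \<forall>j\<in>I. i < j \<longrightarrow> h (x i) \<inter> h (x j) = {}" using indep[OF g] by blast
      have fI: "finite I" using I(1) finite_subset by blast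
      have "(\<Sum>i\<in>I. k) \<le> (\<Sum>i\<in>I. measure M (h (x i)))"
        using I(1) g r(2) unfolding greedy_def h_def by (intro sum_mono) blast
      also have "\<dots> = measure M (\<Union>i\<in>I. h (x i))"
        using hX disj[OF I(3)] fI by (intro finite_measure_finite_Union[symmetric]) auto
      also have "\<dots> \<le> measure M (space M)" by (rule bounded_measure)
      finally have "real (card I) \<le> measure M (space M) / k" using k by (simp add: field_simps)
      then have "(real N + 1) * real (card I) \<le> (real N + 1) * (measure M (space M) / k)"
        by (intro mult_left_mono) auto
      moreover have "real m \<le> (real N + 1) * real (card I)"
        using I(2) by (metis of_nat_1 of_nat_add of_nat_le_iff of_nat_mult)
      ultimately show ?thesis by linarith
    qed
    have "\<exists>m x. greedy m x \<and> X \<subseteq> (\<Union>i<m. h (x i))"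
      unfolding greedy_def
      by (rule greedy_cover[where r=r and h=h, OF r(1) bound[unfolded greedy_def]])
    then obtain m x where g: "greedy m x" and cov: "X \<subseteq> (\<Union>i<m. h (x i))" by blast
    have "measure M X \<le> measure M (\<Union>i<m. h (x i))"
      using cov hX by (intro finite_measure_mono) auto
    also have "\<dots> \<le> (\<Sum>i<m. measure M (h (x i)))"
      using hX by (intro finite_measure_subadditive_finite) auto
    also have "\<dots> \<le> (\<Sum>i<m. k + k/2)"
      using g r(3) unfolding greedy_def h_def by (intro sum_mono) auto
    finally have mX: "measure M (space M) \<le> real m * (k + k/2)" using ball by (simp add: X_def)
    obtain I where I: "I \<subseteq> {..<m}" "m \<le> (N+1) * card I"
      "\<forall>i\<in>I. \<forall>j\<in>I. i < j \<longrightarrow> h (x i) \<inter> h (x j) = {}" using indep[OF g] by blast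
    have fI: "finite I" using I(1) finite_subset by blast
    \<comment> \<open>Nonempty disjoint copies are distinct sets, so the resulting family has
      exactly \<open>card I\<close> members.\<close>
    have ne: "h z \<noteq> {}" for z using K0 by (auto simp: h_def scaled_copy_def)
    have dj: "h (x i) \<inter> h (x j) = {}" if "i \<in> I" "j \<in> I" "i \<noteq> j" for i j
      using disj[OF I(3)] that by (auto simp: disjoint_family_on_def)
    have inj: "inj_on (\<lambda>i. h (x i)) I"
    proof (rule inj_onI)
      fix i j assume "i \<in> I" "j \<in> I" "h (x i) = h (x j)"
      then show "i = j" using dj[of i j] ne[of "x i"] by auto
    qed
    have xX: "x i \<in> X" if "i \<in> I" for i using that I(1) g unfolding greedy_def by blast
    have "real m \<le> (real N + 1) * real (card I)"
      using I(2) by (metis of_nat_1 of_nat_add of_nat_le_iff of_nat_mult)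
    then have "real m * (k + k/2) \<le> (real N + 1) * real (card I) * (k + k/2)"
      using k by (intro mult_right_mono) auto
    then have "measure M (space M) \<le> (real N + 1) * real (card I) * (k + k/2)" using mX by linarith
    then have "2 * measure M (space M) \<le> real (card I) * (k * (3 * (real N + 1)))"
      by (simp add: algebra_simps)
    moreover have "0 < k * (3 * (real N + 1))" using k by simp
    ultimately have "2 * measure M (space M) / (k * (3 * (real N + 1))) \<le> real (card I)"
      by (simp only: pos_divide_le_eq)
    then have cd: "c * measure M (space M) / k \<le> real (card I)"
      by (simp add: c_def mult.commute)
    show "\<exists>F. finite F \<and> F \<subseteq> homothets C \<and> (\<forall>H\<in>F. k \<le> measure M H) \<and>
        pairwise_interior_disjoint F \<and> c * measure M (space M) / k \<le> real (card F)"
    proof (intro exI[of _ "(\<lambda>i. h (x i)) ` I"] conjI)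
      show "(\<lambda>i. h (x i)) ` I \<subseteq> homothets C" using xX r(1) hom by (auto simp: h_def)
      show "\<forall>H\<in>(\<lambda>i. h (x i)) ` I. k \<le> measure M H" using xX r(2) by (auto simp: h_def)
      show "pairwise_interior_disjoint ((\<lambda>i. h (x i)) ` I)"
        unfolding pairwise_interior_disjoint_def pairwise_def
      proof (intro ballI impI)
        fix P Q assume "P \<in> (\<lambda>i. h (x i)) ` I" "Q \<in> (\<lambda>i. h (x i)) ` I" "P \<noteq> Q"
        then have "P \<inter> Q = {}" using dj by blast
        then show "interior P \<inter> interior Q = {}" using interior_subset by blast
      qed
    qed (use fI cd inj in \<open>auto simp: card_image\<close>)
  qed
qed

section \<open>Specialisation to point sets and to nice measures\<close>

theorem mainTheorem3:
  "\<exists>c::real. c > 0 \<and>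
    (\<forall>C::'a::euclidean_space set. convex_body C \<longrightarrow>
      (\<forall>(k::nat) (S::'a set). k > 0 \<and> finite S \<and> card S \<ge> k
          \<and> non_degenerate_pts C (real k / 2) S
          \<longrightarrow> g_pts C k S \<ge> ereal (c * real (card S) / real k))
    \<and> (\<forall>(k::real) (M::'a measure). k > 0 \<and> C_nice C M \<and> measure M (space M) > k
          \<longrightarrow> g_meas C k M \<ge> ereal (c * measure M (space M) / k)))"
proof -
  obtain c where c: "c > 0" and main: "\<And>(C::'a set) M k w \<rho>.
     convex_body C \<Longrightarrow> finite_measure M \<Longrightarrow> sets M = sets borel \<Longrightarrow> 0 < k \<Longrightarrow>
     k \<le> measure M (space M) \<Longrightarrow> measure M (cball w \<rho>) = measure M (space M) \<Longrightarrow>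
     (\<forall>H\<in>homothets C. measure M (frontier H) \<le> k / 2) \<Longrightarrow>
     (\<exists>F. finite F \<and> F \<subseteq> homothets C \<and> (\<forall>H\<in>F. k \<le> measure M H) \<and>
        pairwise_interior_disjoint F \<and> c * measure M (space M) / k \<le> real (card F))"
    using disjoint_heavy_homothets[where 'a='a] by metis
  show ?thesis
  proof (intro exI[of _ c] conjI allI impI)
    fix C :: "'a set" and k :: nat and S :: "'a set"
    assume C: "convex_body C" and a: "k > 0 \<and> finite S \<and> card S \<ge> k \<and> non_degenerate_pts C (real k / 2) S"
    \<comment> \<open>Counting measure on \<open>S\<close>, pushed forward so that it is a Borel
      measure on the whole space.\<close>
    define M where "M = distr (count_space S) borel (\<lambda>x::'a. x)"
    have sM: "sets M = sets borel" and sp: "space M = UNIV" by (auto simp: M_def)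
    have mM: "measure M A = real (card (S \<inter> A))" if "A \<in> sets borel" for A
    proof -
      have "measure M A = measure (count_space S) (A \<inter> S)"
        unfolding M_def using that by (subst measure_distr) auto
      also have "\<dots> = real (card (A \<inter> S))"
        using a by (subst measure_count_space) auto
      finally show ?thesis by (simp add: Int_commute)
    qed
    have fM: "finite_measure M"
      unfolding M_def using a
      by (intro finite_measure.finite_measure_distr finite_measure_count_space) auto
    have "bounded S" using a by (simp add: finite_imp_bounded)
    then obtain \<rho> where \<rho>: "S \<subseteq> cball 0 \<rho>"
      unfolding bounded_iff by (metis mem_cball_0 subsetI)
    have "\<exists>F. finite F \<and> F \<subseteq> homothets C \<and> (\<forall>H\<in>F. real k \<le> measure M H) \<and>
        pairwise_interior_disjoint F \<and> c * measure M (space M) / real k \<le> real (card F)"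
    proof (rule main[OF C fM sM])
      show "measure M (cball 0 \<rho>) = measure M (space M)"
        using \<rho> by (simp add: mM sp Int_absorb2)
      show "\<forall>H\<in>homothets C. measure M (frontier H) \<le> real k / 2"
        using a by (auto simp: mM non_degenerate_pts_def)
    qed (use a in \<open>auto simp: mM sp\<close>)
    then obtain F where F: "finite F" "F \<subseteq> homothets C" "\<forall>H\<in>F. real k \<le> measure M H"
        "pairwise_interior_disjoint F" "c * real (card S) / real k \<le> real (card F)"
      by (auto simp: mM sp)
    \<comment> \<open>Homothets are compact, hence Borel, so their measure is the number of points
      of \<open>S\<close> in them.\<close>
    have "H \<in> sets borel" if "H \<in> homothets C" for H
      using that C unfolding homothets_def convex_body_def
      by (auto intro!: borel_compact compact_continuous_image continuous_intros)
    then have "F \<subseteq> kplus_pts_homothets C k S"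
      using F(2,3) mM unfolding kplus_pts_homothets_def by fastforce
    then have "ereal (real (card F)) \<le> g_pts C k S"
      unfolding g_pts_def using F by (intro Sup_upper) blast
    then show "ereal (c * real (card S) / real k) \<le> g_pts C k S"
      using F(5) order_trans ereal_less_eq(3) by blast
  next
    fix C :: "'a set" and k :: real and M :: "'a measure"
    assume C: "convex_body C" and a: "k > 0 \<and> C_nice C M \<and> measure M (space M) > k"
    have sM: "sets M = sets borel" and fM: "finite_measure M"
      using a by (auto simp: C_nice_def intro!: finite_measureI)
    interpret finite_measure M by fact
    obtain w \<rho> where w: "emeasure M (cball w \<rho>) = emeasure M (space M)"
      using a by (auto simp: C_nice_def)
    have "\<exists>F. finite F \<and> F \<subseteq> homothets C \<and> (\<forall>H\<in>F. k \<le> measure M H) \<and>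
        pairwise_interior_disjoint F \<and> c * measure M (space M) / k \<le> real (card F)"
    proof (rule main[OF C fM sM])
      show "measure M (cball w \<rho>) = measure M (space M)" using w by (simp add: measure_def)
      show "\<forall>H\<in>homothets C. measure M (frontier H) \<le> k / 2"
        using a by (auto simp: C_nice_def non_degenerate_meas_def measure_def)
    qed (use a in auto)
    then obtain F where F: "finite F" "F \<subseteq> homothets C" "\<forall>H\<in>F. k \<le> measure M H"
        "pairwise_interior_disjoint F" "c * measure M (space M) / k \<le> real (card F)" by blast
    have "F \<subseteq> kplus_meas_homothets C k M"
      using F(2,3) unfolding kplus_meas_homothets_def by (auto simp: emeasure_eq_measure ennreal_leI)
    then have "ereal (real (card F)) \<le> g_meas C k M"
      unfolding g_meas_def using F by (intro Sup_upper) blast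
    then show "ereal (c * measure M (space M) / k) \<le> g_meas C k M"
      using F(5) order_trans ereal_less_eq(3) by blast
  qed (rule c)
qed

end
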